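(* Let $X\neq\{0\}$ be a real Hilbert space, let $m\in\mathbb{N}$, let $I:=\{1,2,\ldots,m\}$, and let $\lambda\in(0,2)$. Let $\mathcal{A}:=(A_i)_{i=1}^m$ be an innately regular family of $m$ closed affine subspaces of $X$, and let $\mu_{\mathcal{A},\lambda}>0$ be the Bauschke-Tung constant associated with $\mathcal{A}$ and $\lambda$ (see context). For each $k\in\mathbb{N}\cup\{0\}$ let $J_k$ be a nonempty finite set and let $w_k:J_k\to[0,1]$ be a weight function, i.e. $\sum_{j\in J_k}w_k(j)=1$. For each $k\in\mathbb{N}\cup\{0\}$ and each $j\in J_k$ let $\ell_k(j)\in\mathbb{N}$ be arbitrary, and let $t_k:\{(j,1),(j,2),\ldots,(j,\ell_k(j))\}\to I$ be an arbitrary function. For each $k\in\mathbb{N}\cup\{0\}$, $j\in J_k$ and $h\in\{1,2,\ldots,\ell_k(j)\}$ let $\lambda_{k,h}\in[0,\lambda]$ be arbitrary and let $T_{k,j,h}:X\to X$ be defined by $$T_{k,j,h}:=(1-\lambda_{k,h})\mathrm{Id}+\lambda_{k,h}P_{A_{t_k(j,h)}}.$$ For each $k\in\mathbb{N}\cup\{0\}$ and $j\in J_k$ define the composition $$S(k,j):=T_{k,j,\ell_k(j)}T_{k,j,\ell_k(j)-1}\cdots T_{k,j,1}.$$ For an arbitrary $x^0\in X$ define recursively $$x^{k+1}:=\sum_{j\in J_k}w_k(j)\,S(k,j)(x^k)\qquad\text{for all } k\in\mathbb{N}\cup\{0\}.$$ Then $\|x^k\|\le\|x^0\|+\lambda\mu_{\mathcal{A},\lambda}$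 for each $k\in\mathbb{N}\cup\{0\}$.
   Context: $\mathbb{N}$ denotes the positive integers. For a nonempty closed convex set $C\subseteq X$, $P_C:X\to X$ is the orthogonal (nearest point) projection onto $C$, and $\mathrm{Id}$ is the identity map. For $x\in X$ and $A\subseteq X$, $d(x,A):=\inf\{\|x-a\|\,:\,a\in A\}$. An affine subspace is a set $A=p_A+\widetilde{A}$ with $p_A\in X$ and $\widetilde{A}$ a linear subspace of $X$ (the associated linear subspace). A finite family $(L_i)_{i\in J}$ of closed linear subspaces is regular if there is $\eta>0$ such that $d(x,\bigcap_{i\in J}L_i)\le\eta\max\{d(x,L_i)\,:\,i\in J\}$ for all $x\in X$; it is innately regular if every nonempty subfamily of it is regular. A finite family $(A_i)_{i=1}^m$ of closed affine subspaces is innately regular if the family $(\widetilde{A}_i)_{i=1}^m$ of associated closed linear subspaces is innately regular. Bauschke-Tung constant: let $\mathcal{R}_{\mathcal{A},\lambda}:=\{S:X\to X\,:\,S=(1-\tau)\mathrm{Id}+\tau P_{A},\ \tau\in[0,\lambda],\ A\in\{A_i\,:\,i\in I\}\}$. A known theorem of Bauschke and Tung states that, for $\mathcal{A}$ innately regular and $\lambda\in(0,2)$, there is a constant $\mu_{\mathcal{A},\lambda}>0$, depending only on $\mathcal{A}$ and $\lambda$, such that for all $k\in\mathbb{N}$, all $x^0\in X$ and all $S_{k-1},\ldots,S_0\in\mathcal{R}_{\mathcal{A},\lambda}$ one has $\|S_{k-1}S_{k-2}\cdots S_0(x^0)\|\le\|x^0\|+\lambda\mu_{\mathcal{A},\lambda}$.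 Throughout, $\mu_{\mathcal{A},\lambda}$ denotes a constant with this property. *)

theory Defs
  imports "HOL-Analysis.Analysis"
begin

(* The library's closest_point requires the class heine_borel, which forces finite dimension,
   so the nearest point projection is introduced here for arbitrary real inner product spaces. *)
definition proj :: "'a::real_inner set \<Rightarrow> 'a \<Rightarrow> 'a" where
  "proj C x = (THE p. p \<in> C \<and> (\<forall>y\<in>C. dist x p \<le> dist x y))"

definition relaxed_proj :: "real \<Rightarrow> 'a::real_inner set \<Rightarrow> 'a \<Rightarrow> 'a" where
  "relaxed_proj \<tau> C = (\<lambda>x. (1 - \<tau>) *\<^sub>R x + \<tau> *\<^sub>R proj C x)"

(* affine_parallel L A unfolds to: A = p + L for some p.  The linear subspace L is unique for
   every nonempty affine A, see direction_eqI below. *)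
definition direction :: "'a::real_vector set \<Rightarrow> 'a set" where
  "direction A = (THE L. subspace L \<and> affine_parallel L A)"

lemma direction_eqI:
  assumes "subspace L" and "A = (\<lambda>x. p + x) ` L"
  shows "direction A = L"
  unfolding direction_def
proof (rule the_equality)
  show "subspace L \<and> affine_parallel L A"
    using assms unfolding affine_parallel_def by blast
next
  fix M assume M: "subspace M \<and> affine_parallel M A"
  have "affine_parallel L A"
    using assms(2) unfolding affine_parallel_def by blast
  then have "affine_parallel M L"
    using M affine_parallel_assoc[of M A L] affine_parallel_commute[of L A] by simp
  then show "M = L"
    using M assms(1) parallel_subspace[of M L] by simp
qed

lemma affine_nonempty_iff:
  "affine A \<and> A \<noteq> {} \<longleftrightarrow> (\<exists>p L. subspace L \<and> A = (\<lambda>x. p + x) ` L)"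
proof
  assume "affine A \<and> A \<noteq> {}"
  then obtain L where "subspace L" "affine_parallel A L"
    using affine_parallel_subspace[of A] by auto
  then show "\<exists>p L. subspace L \<and> A = (\<lambda>x. p + x) ` L"
    using affine_parallel_commute[of A L] unfolding affine_parallel_def by blast
next
  assume "\<exists>p L. subspace L \<and> A = (\<lambda>x. p + x) ` L"
  then obtain p L where L: "subspace L" "A = (\<lambda>x. p + x) ` L" by blast
  then have "affine A"
    using affine_translation[of L p] subspace_imp_affine[of L] by simp
  moreover have "A \<noteq> {}"
    using subspace_0[OF L(1)] L(2) by auto
  ultimately show "affine A \<and> A \<noteq> {}" by blast
qed

(* Meant for a finite nonempty index set J and closed linear subspaces L i; all the sets are
   then nonempty, so that infdist is the usual distance. *)
definition regular_family :: "'i set \<Rightarrow> ('i \<Rightarrow> 'a::real_normed_vector set) \<Rightarrow> bool" where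
  "regular_family J L \<longleftrightarrow>
     (\<exists>\<eta>>0. \<forall>x. infdist x (\<Inter>i\<in>J. L i) \<le> \<eta> * Max ((\<lambda>i. infdist x (L i)) ` J))"

definition innately_regular :: "'i set \<Rightarrow> ('i \<Rightarrow> 'a::real_normed_vector set) \<Rightarrow> bool" where
  "innately_regular J L \<longleftrightarrow> (\<forall>K. K \<subseteq> J \<and> K \<noteq> {} \<longrightarrow> regular_family K L)"

definition innately_regular_affine :: "'i set \<Rightarrow> ('i \<Rightarrow> 'a::real_normed_vector set) \<Rightarrow> bool" where
  "innately_regular_affine J A \<longleftrightarrow> innately_regular J (\<lambda>i. direction (A i))"

definition relaxed_projs :: "'i set \<Rightarrow> ('i \<Rightarrow> 'a::real_inner set) \<Rightarrow> real \<Rightarrow> ('a \<Rightarrow> 'a) set" where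
  "relaxed_projs J A \<Lambda> = {S. \<exists>\<tau>\<in>{0..\<Lambda>}. \<exists>i\<in>J. S = relaxed_proj \<tau> (A i)}"

(* fold S [0..<k] is the composition S (k - 1) o ... o S 0, with S 0 applied first. *)
definition bauschke_tung_constant ::
    "'i set \<Rightarrow> ('i \<Rightarrow> 'a::real_inner set) \<Rightarrow> real \<Rightarrow> real \<Rightarrow> bool" where
  "bauschke_tung_constant J A \<Lambda> \<mu> \<longleftrightarrow> \<mu> > 0 \<and>
     (\<forall>k\<ge>1. \<forall>x0. \<forall>S :: nat \<Rightarrow> 'a \<Rightarrow> 'a.
        (\<forall>i<k. S i \<in> relaxed_projs J A \<Lambda>) \<longrightarrow>
        norm (fold S [0..<k] x0) \<le> norm x0 + \<Lambda> * \<mu>)"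

end

(* Relaxed projections onto closed affine subspaces are affine maps. They therefore map the
   convex hull of the set of all points reachable from x 0 by finite compositions of relaxed
   projections into itself, and so the whole sequence stays in that convex hull. The
   Bauschke-Tung bound puts the reachable points, and hence their hull, in a ball. *)
theory Submission
  imports Defs
begin

text \<open>Intersecting \<open>A\<close> with balls around \<open>x\<close> whose radii decrease to
  the distance \<open>d\<close> gives nested closed nonempty sets. The parallelogram law makes their
  diameters tend to 0, so by completeness they share a point, which must lie at distance exactly
  \<open>d\<close>.\<close>

lemma affine_nearest_point_exists:
  fixes A :: "'a::{real_inner, complete_space} set"
  assumes "affine A" "A \<noteq> {}" "closed A"
  obtains p where "p \<in> A" "\<And>y. y \<in> A \<Longrightarrow> dist x p \<le> dist x y"
proof -
  define d where "d = infdist x A"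
  have d0: "0 \<le> d" unfolding d_def by (rule infdist_nonneg)
  have d_le: "d \<le> dist x y" if "y \<in> A" for y
    unfolding d_def using that by (rule infdist_le)
  \<comment> \<open>The excess over \<open>d\<close> is measured in squares because the
    parallelogram law is an identity between squared distances: it turns the slack 1/(n+1) directly
    into the bound 4/(n+1) in \<open>diam\<close>.\<close>
  define r where "r n = sqrt (d\<^sup>2 + 1 / real (Suc n))" for n
  have r2: "(r n)\<^sup>2 = d\<^sup>2 + 1 / real (Suc n)" for n
    unfolding r_def by simp
  have r0: "0 \<le> r n" for n unfolding r_def by simp
  define B where "B n = A \<inter> cball x (r n)" for n
  have ne: "B n \<noteq> {}" for n
  proof -
    have "d < r n"
      using d0 r0[of n] by (intro power_less_imp_less_base[of d 2 "r n"]) (simp_all add: r2)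
    then have "(INF a\<in>A. dist x a) < r n"
      using assms(2) unfolding d_def infdist_def by simp
    then obtain a where "a \<in> A" "dist x a < r n"
      using assms(2) by (subst (asm) cINF_less_iff) auto
    then show ?thesis unfolding B_def by auto
  qed
  have diam: "(dist a b)\<^sup>2 \<le> 4 / real (Suc n)" if "a \<in> B n" "b \<in> B n" for a b n
  proof -
    let ?c = "(1/2) *\<^sub>R a + (1/2) *\<^sub>R b"
    have "?c \<in> A"
      using that assms(1) unfolding B_def by (auto intro!: mem_affine)
    then have "d\<^sup>2 \<le> (dist x ?c)\<^sup>2"
      using d_le d0 by (simp add: power_mono)
    moreover have "(dist x a)\<^sup>2 \<le> (r n)\<^sup>2" "(dist x b)\<^sup>2 \<le> (r n)\<^sup>2"
      using that unfolding B_def by (auto intro!: power_mono)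
    \<comment> \<open>Parallelogram law for \<open>x - a\<close> and \<open>x - b\<close>. The
      midpoint \<open>?c\<close> lies in \<open>A\<close>, so the subtracted term is at least four
      times the square of \<open>d\<close>.\<close>
    moreover have "(dist a b)\<^sup>2 = 2 * (dist x a)\<^sup>2 + 2 * (dist x b)\<^sup>2 - 4 * (dist x ?c)\<^sup>2"
      by (simp add: dist_norm power2_norm_eq_inner inner_simps inner_commute field_simps)
    ultimately show ?thesis by (simp add: r2)
  qed
  have "\<exists>p. \<forall>n. p \<in> B n"
  proof (rule decreasing_closed_nest)
    show "closed (B n)" for n unfolding B_def using assms(3) by auto
    show "B n \<noteq> {}" for n by (rule ne)
    show "B n \<subseteq> B k" if "k \<le> n" for k n
    proof -
      have "r n \<le> r k" unfolding r_def using that by (simp add: frac_le)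
      then show ?thesis unfolding B_def by auto
    qed
    fix e :: real assume e: "0 < e"
    then obtain n where n: "4 / e\<^sup>2 < real n" using reals_Archimedean2 by blast
    have "dist a b < e" if "a \<in> B n" "b \<in> B n" for a b
    proof (rule power_less_imp_less_base[of _ 2])
      have "(dist a b)\<^sup>2 \<le> 4 / real (Suc n)" by (rule diam[OF that])
      also have "\<dots> < e\<^sup>2"
      proof -
        have "4 < real n * e\<^sup>2" using n e by (simp add: divide_less_eq)
        also have "\<dots> \<le> real (Suc n) * e\<^sup>2" by (simp add: mult_right_mono)
        finally show ?thesis by (simp add: divide_less_eq mult.commute)
      qed
      finally show "(dist a b)\<^sup>2 < e\<^sup>2" .
    qed (use e in simp)
    then show "\<exists>n. \<forall>a\<in>B n. \<forall>b\<in>B n. dist a b < e" by blast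
  qed blast
  then obtain p where p: "\<And>n. p \<in> B n" by blast
  have "(dist x p)\<^sup>2 - d\<^sup>2 \<le> 0"
  proof (rule LIMSEQ_le_const[OF LIMSEQ_Suc[OF lim_1_over_n]])
    have "(dist x p)\<^sup>2 - d\<^sup>2 \<le> 1 / real (Suc n)" for n
    proof -
      have "(dist x p)\<^sup>2 \<le> (r n)\<^sup>2" using p[of n] unfolding B_def by (auto intro!: power_mono)
      then show ?thesis by (simp add: r2)
    qed
    then show "\<exists>N. \<forall>n\<ge>N. (dist x p)\<^sup>2 - d\<^sup>2 \<le> 1 / real (Suc n)" by blast
  qed
  then have "dist x p \<le> d"
    using d0 power2_le_imp_le[of "dist x p" d] by simp
  moreover have "p \<in> A" using p[of 0] unfolding B_def by simp
  ultimately show ?thesis using d_le that by (meson order_trans)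
qed

text \<open>The line through \<open>p\<close> and \<open>y\<close> stays in \<open>A\<close>, and
  the squared distance to \<open>x\<close> along it is a quadratic with its minimum at
  \<open>p\<close>, so its linear coefficient vanishes.\<close>

lemma nearest_point_orthogonal:
  fixes A :: "'a::real_inner set"
  assumes "affine A" "p \<in> A" "\<And>y. y \<in> A \<Longrightarrow> dist x p \<le> dist x y" "y \<in> A"
  shows "inner (x - p) (y - p) = 0"
proof (cases "y = p")
  case False
  define v where "v = y - p"
  \<comment> \<open>The minimiser of that quadratic: moving from \<open>p\<close> by
    \<open>s\<close> times \<open>v\<close> lowers the squared distance by the square of
    \<open>inner (x - p) v\<close> divided by \<open>inner v v\<close>, which must therefore be
    0.\<close>
  define s where "s = inner (x - p) v / inner v v"
  have v: "0 < inner v v" using False unfolding v_def by simp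
  have "(1 - s) *\<^sub>R p + s *\<^sub>R y \<in> A"
    using assms by (intro mem_affine) auto
  then have "p + s *\<^sub>R v \<in> A" unfolding v_def by (simp add: algebra_simps)
  then have "(dist x p)\<^sup>2 \<le> (dist x (p + s *\<^sub>R v))\<^sup>2"
    using assms(3) by (simp add: power_mono)
  also have "\<dots> = (dist x p)\<^sup>2 - 2 * s * inner (x - p) v + s * (s * inner v v)"
    by (simp add: dist_norm power2_norm_eq_inner inner_simps inner_commute algebra_simps)
  also have "s * inner v v = inner (x - p) v" using v unfolding s_def by simp
  finally have "(inner (x - p) v)\<^sup>2 / inner v v \<le> 0"
    unfolding s_def by (simp add: power2_eq_square)
  then show ?thesis using v unfolding v_def by (simp add: divide_le_0_iff)
qed simp

text \<open>Pythagoras makes every other point of \<open>A\<close> strictly farther from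
  \<open>x\<close> than \<open>p\<close>. This gives both the existence and the uniqueness that the
  \<open>THE\<close> in \<open>proj\<close> requires.\<close>

lemma proj_eqI:
  assumes "p \<in> A" "\<And>y. y \<in> A \<Longrightarrow> inner (x - p) (y - p) = 0"
  shows "proj A x = p"
proof -
  have pyth: "(dist x y)\<^sup>2 = (dist x p)\<^sup>2 + (dist p y)\<^sup>2" if "y \<in> A" for y
    using assms(2)[OF that]
    by (simp add: dist_norm power2_norm_eq_inner inner_simps inner_commute)
  show ?thesis
    unfolding proj_def
  proof (rule the_equality)
    show "p \<in> A \<and> (\<forall>y\<in>A. dist x p \<le> dist x y)"
    proof (intro conjI ballI)
      fix y assume "y \<in> A"
      then have "(dist x p)\<^sup>2 \<le> (dist x y)\<^sup>2" using pyth by simp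
      then show "dist x p \<le> dist x y" by (rule power2_le_imp_le) simp
    qed (rule assms(1))
  next
    fix q assume q: "q \<in> A \<and> (\<forall>y\<in>A. dist x q \<le> dist x y)"
    then have "(dist x q)\<^sup>2 \<le> (dist x p)\<^sup>2"
      using assms(1) by (simp add: power_mono)
    then show "q = p" using pyth[of q] q by simp
  qed
qed

text \<open>Being orthogonal to all differences of points of \<open>A\<close> is a linear condition
  on the residual, so it passes from the residuals of \<open>x\<close> and \<open>y\<close> to their
  combination, and \<open>proj_eqI\<close> then identifies the projection.\<close>

lemma proj_affine:
  fixes A :: "'a::{real_inner, complete_space} set"
  assumes A: "affine A" "A \<noteq> {}" "closed A" and uv: "u + v = 1"
  shows "proj A (u *\<^sub>R x + v *\<^sub>R y) = u *\<^sub>R proj A x + v *\<^sub>R proj A y"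
proof -
  have *: "proj A z \<in> A \<and> (\<forall>b\<in>A. inner (z - proj A z) (b - proj A z) = 0)" for z
  proof -
    obtain p where "p \<in> A" "\<And>b. b \<in> A \<Longrightarrow> dist z p \<le> dist z b"
      using affine_nearest_point_exists[OF A] by blast
    then have "p \<in> A \<and> (\<forall>b\<in>A. inner (z - p) (b - p) = 0)"
      using nearest_point_orthogonal[OF A(1)] by blast
    then show ?thesis using proj_eqI[of p A z] by simp
  qed
  define p q where "p = proj A x" and "q = proj A y"
  have pq: "p \<in> A" "q \<in> A" using * unfolding p_def q_def by auto
  \<comment> \<open>Arbitrary differences \<open>a - b\<close> are needed, since the candidate
    projection is in general neither \<open>p\<close> nor \<open>q\<close>.\<close>
  have orth: "inner (x - p) (a - b) = 0" "inner (y - q) (a - b) = 0" if "a \<in> A" "b \<in> A" for a b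
  proof -
    have "inner (x - p) (a - p) = 0" "inner (x - p) (b - p) = 0"
      "inner (y - q) (a - q) = 0" "inner (y - q) (b - q) = 0"
      using * that unfolding p_def q_def by blast+
    then show "inner (x - p) (a - b) = 0" "inner (y - q) (a - b) = 0"
      by (simp_all add: inner_diff_right)
  qed
  have mem: "u *\<^sub>R p + v *\<^sub>R q \<in> A" using A(1) pq uv by (rule mem_affine)
  have "proj A (u *\<^sub>R x + v *\<^sub>R y) = u *\<^sub>R p + v *\<^sub>R q"
  proof (rule proj_eqI[OF mem])
    fix b assume b: "b \<in> A"
    have "u *\<^sub>R x + v *\<^sub>R y - (u *\<^sub>R p + v *\<^sub>R q) = u *\<^sub>R (x - p) + v *\<^sub>R (y - q)"
      by (simp add: algebra_simps)
    then show "inner (u *\<^sub>R x + v *\<^sub>R y - (u *\<^sub>R p + v *\<^sub>R q)) (b - (u *\<^sub>R p + v *\<^sub>R q)) = 0"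
      using orth[OF b mem] by (simp add: inner_add_left)
  qed
  then show ?thesis unfolding p_def q_def .
qed

lemma relaxed_proj_affine:
  fixes A :: "'a::{real_inner, complete_space} set"
  assumes "affine A" "A \<noteq> {}" "closed A" "u + v = 1"
  shows "relaxed_proj \<tau> A (u *\<^sub>R x + v *\<^sub>R y) = u *\<^sub>R relaxed_proj \<tau> A x + v *\<^sub>R relaxed_proj \<tau> A y"
  unfolding relaxed_proj_def proj_affine[OF assms] by (simp add: algebra_simps)

text \<open>The preimage of the hull under \<open>f\<close> is convex and contains \<open>Y\<close>,
  hence contains the hull by minimality.\<close>

lemma convex_hull_invariant:
  assumes "\<And>x y u v. 0 \<le> u \<Longrightarrow> 0 \<le> v \<Longrightarrow> u + v = 1 \<Longrightarrow>
             f (u *\<^sub>R x + v *\<^sub>R y) = u *\<^sub>R f x + v *\<^sub>R f y"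
    and "f ` Y \<subseteq> Y" and "z \<in> convex hull Y"
  shows "f z \<in> convex hull Y"
proof -
  have "convex (f -` (convex hull Y))"
    using assms(1) by (intro convexI) (auto intro: convexD[OF convex_convex_hull])
  moreover have "Y \<subseteq> f -` (convex hull Y)"
    using assms(2) hull_subset[of Y convex] by blast
  ultimately have "convex hull Y \<subseteq> f -` (convex hull Y)" by (rule hull_minimal[rotated])
  then show ?thesis using assms(3) by blast
qed

lemma fold_invariant_mem:
  assumes "\<And>h y. h \<in> set hs \<Longrightarrow> y \<in> C \<Longrightarrow> f h y \<in> C" "y \<in> C"
  shows "fold f hs y \<in> C"
  using assms by (induction hs arbitrary: y) auto

theorem theorem5:
  fixes A :: "nat \<Rightarrow> 'a::{real_inner, complete_space} set"
    and m :: nat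
    and \<Lambda> \<mu> :: real
    and J :: "nat \<Rightarrow> 'j set"
    and w :: "nat \<Rightarrow> 'j \<Rightarrow> real"
    and l :: "nat \<Rightarrow> 'j \<Rightarrow> nat"
    and t :: "nat \<Rightarrow> 'j \<times> nat \<Rightarrow> nat"
    and lam :: "nat \<Rightarrow> nat \<Rightarrow> real"
    and T :: "nat \<Rightarrow> 'j \<Rightarrow> nat \<Rightarrow> 'a \<Rightarrow> 'a"
    and S :: "nat \<Rightarrow> 'j \<Rightarrow> 'a \<Rightarrow> 'a"
    and x :: "nat \<Rightarrow> 'a"
  assumes X_nontrivial: "\<exists>v :: 'a. v \<noteq> 0"
    and m: "m \<ge> 1"
    and \<Lambda>: "0 < \<Lambda>" "\<Lambda> < 2"
    and A: "\<And>i. i \<in> {1..m} \<Longrightarrow> affine (A i) \<and> A i \<noteq> {} \<and> closed (A i)"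
    and regular: "innately_regular_affine {1..m} A"
    and \<mu>: "bauschke_tung_constant {1..m} A \<Lambda> \<mu>"
    and J: "\<And>k. finite (J k) \<and> J k \<noteq> {}"
    and w: "\<And>k j. j \<in> J k \<Longrightarrow> w k j \<in> {0..1}"
    and w_sum: "\<And>k. (\<Sum>j\<in>J k. w k j) = 1"
    and l: "\<And>k j. j \<in> J k \<Longrightarrow> l k j \<ge> 1"
    and t: "\<And>k j h. j \<in> J k \<Longrightarrow> h \<in> {1..l k j} \<Longrightarrow> t k (j, h) \<in> {1..m}"
    and lam: "\<And>k j h. j \<in> J k \<Longrightarrow> h \<in> {1..l k j} \<Longrightarrow> lam k h \<in> {0..\<Lambda>}"
    and T: "\<And>k j h. j \<in> J k \<Longrightarrow> h \<in> {1..l k j} \<Longrightarrow>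
              T k j h = relaxed_proj (lam k h) (A (t k (j, h)))"
    and S: "\<And>k j. j \<in> J k \<Longrightarrow> S k j = fold (T k j) [1..<Suc (l k j)]"
    and x: "\<And>k. x (Suc k) = (\<Sum>j\<in>J k. w k j *\<^sub>R S k j (x k))"
  shows "\<forall>k. norm (x k) \<le> norm (x 0) + \<Lambda> * \<mu>"
proof -
  define R where "R = relaxed_projs {1..m} A \<Lambda>"
  \<comment> \<open>The points reachable from \<open>x 0\<close>. The case \<open>k = 0\<close> is
    allowed so that \<open>x 0\<close> itself belongs to \<open>Y\<close>.\<close>
  define Y where "Y = {fold F [0..<k] (x 0) |F k. \<forall>i<k. F i \<in> R}"
  have R_Y: "f ` Y \<subseteq> Y" if f: "f \<in> R" for f
  proof clarify
    fix y assume "y \<in> Y"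
    then obtain F k where F: "y = fold F [0..<k] (x 0)" "\<forall>i<k. F i \<in> R"
      unfolding Y_def by blast
    \<comment> \<open>Only the values of \<open>F\<close> below \<open>k\<close> enter the
      composition, so position \<open>k\<close> is free to hold \<open>f\<close> as the map applied
      last.\<close>
    have "fold (F(k := f)) [0..<k] (x 0) = fold F [0..<k] (x 0)"
      by (rule fold_cong) auto
    then have "f y = fold (F(k := f)) [0..<Suc k] (x 0)"
      using F(1) by simp
    moreover have "\<forall>i<Suc k. (F(k := f)) i \<in> R"
      using F(2) f by (simp add: less_Suc_eq)
    ultimately show "f y \<in> Y" unfolding Y_def by blast
  qed
  have R_hull: "f y \<in> convex hull Y" if f: "f \<in> R" and y: "y \<in> convex hull Y" for f y
  proof (rule convex_hull_invariant[OF _ R_Y[OF f] y])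
    fix a b :: 'a and u v :: real
    assume uv: "u + v = 1"
    obtain \<tau> i where i: "i \<in> {1..m}" "f = relaxed_proj \<tau> (A i)"
      using f unfolding R_def relaxed_projs_def by blast
    show "f (u *\<^sub>R a + v *\<^sub>R b) = u *\<^sub>R f a + v *\<^sub>R f b"
      using relaxed_proj_affine[of "A i" u v] A[OF i(1)] uv unfolding i(2) by blast
  qed
  have T_R: "T k j h \<in> R" if "j \<in> J k" "h \<in> {1..l k j}" for k j h
    using T[OF that] t[OF that] lam[OF that] unfolding R_def relaxed_projs_def by blast
  have x_hull: "x k \<in> convex hull Y" for k
  proof (induction k)
    case 0
    have "x 0 = fold (\<lambda>_. id) [0..<0] (x 0)" by simp
    then have "x 0 \<in> Y" unfolding Y_def by blast
    then show ?case by (rule hull_inc)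
  next
    case (Suc k)
    \<comment> \<open>After averaging, \<open>x k\<close> is known to lie only in the hull and not
      in \<open>Y\<close>, so the factors of \<open>S k j\<close> are followed one at a time through
      the hull by \<open>R_hull\<close>.\<close>
    have "S k j (x k) \<in> convex hull Y" if j: "j \<in> J k" for j
      unfolding S[OF j]
    proof (rule fold_invariant_mem[OF _ Suc])
      fix h y assume "h \<in> set [1..<Suc (l k j)]" "y \<in> convex hull Y"
      then show "T k j h y \<in> convex hull Y" using R_hull T_R[OF j, of h] by auto
    qed
    then show ?case
      unfolding x using J[of k] w[of _ k] w_sum[of k]
      by (intro convex_sum convex_convex_hull) auto
  qed
  have "Y \<subseteq> cball 0 (norm (x 0) + \<Lambda> * \<mu>)"
  proof
    fix y assume "y \<in> Y"
    then obtain F k where F: "y = fold F [0..<k] (x 0)" "\<forall>i<k. F i \<in> R"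
      unfolding Y_def by blast
    have "norm y \<le> norm (x 0) + \<Lambda> * \<mu>"
    \<comment> \<open>The Bauschke-Tung bound speaks only of compositions of at least one map. For
      the empty one the claim follows from the positivity of \<open>\<Lambda>\<close> and
      \<open>\<mu>\<close>.\<close>
    proof (cases "k = 0")
      case True
      then show ?thesis using F(1) \<mu> \<Lambda>(1) unfolding bauschke_tung_constant_def by simp
    next
      case False
      then show ?thesis using F \<mu> unfolding bauschke_tung_constant_def R_def by simp
    qed
    then show "y \<in> cball 0 (norm (x 0) + \<Lambda> * \<mu>)" by simp
  qed
  then have "convex hull Y \<subseteq> cball 0 (norm (x 0) + \<Lambda> * \<mu>)"
    by (rule hull_minimal) (rule convex_cball)
  then show ?thesis using x_hull by (auto simp: subset_iff)
qed

end
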